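(* Let $n,q$ be coprime integers with $1<q<n$, let $\frac{n}{n-q}=[a_2,\dots,a_{e-1}]$ be the Hirzebruch-Jung expansion with $e\ge4$, let $\alpha,\beta,s_3,\widehat s_3$ be as in the context, and let $$F=y^{2\alpha+2s_3}+x^{a_2-1}y^{2\alpha}z^{2\widehat s_3}-xz^{2\beta+2\widehat s_3}\in\mathbb C[x,y,z].$$ (i) For $0\le i\le 2\alpha-1$ and $0\le j\le2\beta+2\widehat s_3-1$ define $$A^{(1)}_{i,j}=\begin{pmatrix} y^{2\alpha-i}&xz^j\\ z^{2\beta+2\widehat s_3-j}&y^i(y^{2s_3}+x^{a_2-1}z^{2\widehat s_3})\end{pmatrix},\quad B^{(1)}_{i,j}=\begin{pmatrix} y^i(y^{2s_3}+x^{a_2-1}z^{2\widehat s_3})&-xz^j\\ -z^{2\beta+2\widehat s_3-j}&y^{2\alpha-i}\end{pmatrix}.$$ (ii) For $1\le j\le 2\alpha+2s_3-1$ define $$A^{(2)}_j=\begin{pmatrix} x&y^j\\ -y^{2\alpha+2s_3-j}&z^{2\widehat s_3}(x^{a_2-2}y^{2\alpha}-z^{2\beta})\end{pmatrix},\quad B^{(2)}_j=\begin{pmatrix} z^{2\widehat s_3}(x^{a_2-2}y^{2\alpha}-z^{2\beta})&-y^j\\ y^{2\alpha+2s_3-j}&x\end{pmatrix}.$$ (iii) For $0\le i\le2\widehat s_3-1$ and $1\le j\le2\alpha+2s_3-1$ define $$A^{(3)}_{i,j}=\begin{pmatrix} z^{2\widehat s_3-i}&y^j\\ -y^{2\alpha+2s_3-j}&xz^i(x^{a_2-2}y^{2\alpha}-z^{2\beta})\end{pmatrix},\quad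 B^{(3)}_{i,j}=\begin{pmatrix} xz^i(x^{a_2-2}y^{2\alpha}-z^{2\beta})&-y^j\\ y^{2\alpha+2s_3-j}&z^{2\widehat s_3-i}\end{pmatrix}.$$ Then $A^{(\ell)}_{i,j}B^{(\ell)}_{i,j}=B^{(\ell)}_{i,j}A^{(\ell)}_{i,j}=F\,\mathrm{Id}_2$ for $\ell=1,3$, and $A^{(2)}_jB^{(2)}_j=B^{(2)}_jA^{(2)}_j=F\,\mathrm{Id}_2$. Hence each pair above is a $2\times2$ matrix factorization of $F$.
   Context: $[c_1,\dots,c_m]=c_1-\cfrac{1}{c_2-\cfrac{1}{\ddots-\cfrac1{c_m}}}$ with integers $c_i\ge2$. A $2\times 2$ matrix factorization of $F$ is a pair of $2\times2$ matrices over $\mathbb C[x,y,z]$ with both products equal to $F\,\mathrm{Id}_2$. Exponents. For $e\ge5$: $s_e=0$, $s_{e-1}=1$, $s_{e-2}=a_{e-1}$, and $s_j=(a_{j+1}-1)s_{j+1}+(a_{j+2}-1)s_{j+2}-s_{j+3}$ for $3\le j\le e-3$; $\widehat s_{e-1}=0$, $\widehat s_{e-2}=1$, $\widehat s_{e-3}=a_{e-2}$, and $\widehat s_j=(a_{j+1}-1)\widehat s_{j+1}+(a_{j+2}-1)\widehat s_{j+2}-\widehat s_{j+3}$ for $3\le j\le e-4$; $\alpha=1+\sum_{j=3}^{e-1}(a_j-2)s_j$, $\beta=1+\sum_{j=3}^{e-2}(a_j-2)\widehat s_j$. For $e=4$: $s_3=1$, $\widehat s_3=0$, $\alpha=a_3-1$,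 $\beta=1$. *)

theory Defs
  imports "HOL-Analysis.Analysis" "HOL-Library.Poly_Mapping"
begin

section \<open>The polynomial ring in three variables\<close>

datatype xyz = VarX | VarY | VarZ

text \<open>Exponent vectors are finitely supported maps from the three variables to the naturals;
  a polynomial is a finitely supported map from exponent vectors to coefficients.\<close>

type_synonym cpoly3 = "(xyz \<Rightarrow>\<^sub>0 nat) \<Rightarrow>\<^sub>0 complex"

definition Var :: "xyz \<Rightarrow> cpoly3" where
  "Var v = Poly_Mapping.single (Poly_Mapping.single v 1) 1"

abbreviation "pX \<equiv> Var VarX"
abbreviation "pY \<equiv> Var VarY"
abbreviation "pZ \<equiv> Var VarZ"

section \<open>Matrix factorizations\<close>

definition matrix2 :: "'a::zero \<Rightarrow> 'a \<Rightarrow> 'a \<Rightarrow> 'a \<Rightarrow> 'a^2^2" where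
  "matrix2 p q r s = vector [vector [p, q], vector [r, s]]"

text \<open>The library's \<open>mat F\<close> is the scalar matrix with \<open>F\<close> on the diagonal.\<close>

definition is_matrix_factorization :: "cpoly3 \<Rightarrow> (cpoly3^2^2) \<times> (cpoly3^2^2) \<Rightarrow> bool" where
  "is_matrix_factorization F P \<longleftrightarrow> fst P ** snd P = mat F \<and> snd P ** fst P = mat F"

section \<open>Hirzebruch-Jung continued fractions\<close>

fun hj :: "int list \<Rightarrow> rat" where
  "hj [c] = of_int c"
| "hj (c # d # cs) = of_int c - 1 / hj (d # cs)"

text \<open>The expansion \<open>r = [a\<^sub>2, \<dots>, a\<^bsub>e-1\<^esub>]\<close>; only the values \<open>a i\<close> with \<open>2 \<le> i < e\<close> matter.\<close>

definition is_hj_expansion :: "rat \<Rightarrow> nat \<Rightarrow> (nat \<Rightarrow> int) \<Rightarrow> bool" where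
  "is_hj_expansion r e a \<longleftrightarrow> (\<forall>i\<in>{2..<e}. a i \<ge> 2) \<and> r = hj (map a [2..<e])"

section \<open>The exponents\<close>

text \<open>The sequences are defined by downward recursion and are used only for \<open>3 \<le> j\<close>, with
  \<open>j \<le> e\<close> for \<open>s_exp\<close> and \<open>j \<le> e - 1\<close> for \<open>shat_exp\<close>. The values for \<open>e = 4\<close>, which are
  prescribed separately, are those given by the same formulas (lemma \<open>exponents_4\<close>).\<close>

function s_exp :: "(nat \<Rightarrow> int) \<Rightarrow> nat \<Rightarrow> nat \<Rightarrow> int" where
  "s_exp a e j =
    (if j \<ge> e then 0
     else if j + 1 = e then 1
     else if j + 2 = e then a (e - 1)
     else (a (j+1) - 1) * s_exp a e (j+1) + (a (j+2) - 1) * s_exp a e (j+2) - s_exp a e (j+3))"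
  by pat_completeness auto
termination by (relation "Wellfounded.measure (\<lambda>(a, e, j). e - j)") auto

function shat_exp :: "(nat \<Rightarrow> int) \<Rightarrow> nat \<Rightarrow> nat \<Rightarrow> int" where
  "shat_exp a e j =
    (if j + 1 \<ge> e then 0
     else if j + 2 = e then 1
     else if j + 3 = e then a (e - 2)
     else (a (j+1) - 1) * shat_exp a e (j+1) + (a (j+2) - 1) * shat_exp a e (j+2)
            - shat_exp a e (j+3))"
  by pat_completeness auto
termination by (relation "Wellfounded.measure (\<lambda>(a, e, j). e - j)") auto

declare s_exp.simps [simp del] shat_exp.simps [simp del]

definition alpha_exp :: "(nat \<Rightarrow> int) \<Rightarrow> nat \<Rightarrow> int" where
  "alpha_exp a e = 1 + (\<Sum>j=3..e-1. (a j - 2) * s_exp a e j)"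

definition beta_exp :: "(nat \<Rightarrow> int) \<Rightarrow> nat \<Rightarrow> int" where
  "beta_exp a e = 1 + (\<Sum>j=3..e-2. (a j - 2) * shat_exp a e j)"

lemma exponents_4:
  "s_exp a 4 3 = 1" "shat_exp a 4 3 = 0" "alpha_exp a 4 = a 3 - 1" "beta_exp a 4 = 1"
  by (simp_all add: alpha_exp_def beta_exp_def s_exp.simps shat_exp.simps)

text \<open>The exponents are integers, converted to naturals in the powers below. The following bounds
  show that this conversion never truncates.\<close>

lemma s_exp_mono:
  assumes "\<forall>i\<in>{2..<e}. a i \<ge> 2" "2 \<le> j"
  shows "0 \<le> s_exp a e (j+1) \<and> s_exp a e (j+1) \<le> s_exp a e j"
  using assms(2)
proof (induction "e - j" arbitrary: j rule: less_induct)
  case less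
  consider "j \<ge> e" | "j + 1 = e" | "j + 2 = e" | "j + 2 < e" by linarith
  then show ?case
  proof cases
    case 3
    then have "a (e - 1) \<ge> 2" using assms(1) less.prems by auto
    with 3 show ?thesis by (auto simp: s_exp.simps)
  next
    case 4
    have a: "a (j+1) \<ge> 2" "a (j+2) \<ge> 2" using assms(1) 4 less.prems by auto
    have 1: "0 \<le> s_exp a e (j+2) \<and> s_exp a e (j+2) \<le> s_exp a e (j+1)"
      using less.hyps[of "j+1"] 4 less.prems by (simp add: numeral_eq_Suc)
    have 2: "0 \<le> s_exp a e (j+3) \<and> s_exp a e (j+3) \<le> s_exp a e (j+2)"
      using less.hyps[of "j+2"] 4 less.prems by (simp add: numeral_eq_Suc)
    have "1 * s_exp a e (j+1) \<le> (a (j+1) - 1) * s_exp a e (j+1)"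
      "1 * s_exp a e (j+2) \<le> (a (j+2) - 1) * s_exp a e (j+2)"
      using a 1 2 by (intro mult_right_mono; linarith)+
    moreover have "s_exp a e j = (a (j+1) - 1) * s_exp a e (j+1)
        + (a (j+2) - 1) * s_exp a e (j+2) - s_exp a e (j+3)"
      using 4 by (subst s_exp.simps) auto
    ultimately show ?thesis using 1 2 by linarith
  qed (auto simp: s_exp.simps)
qed

lemma shat_exp_eq: "shat_exp a e j = s_exp a (e - 1) j"
proof (induction a e j rule: shat_exp.induct)
  case (1 a e j)
  then show ?case
    by (subst shat_exp.simps, subst s_exp.simps)
       (auto simp: numeral_eq_Suc)
qed

lemma exponent_bounds:
  assumes "\<forall>i\<in>{2..<e}. a i \<ge> 2"
  shows "s_exp a e 3 \<ge> 0" "shat_exp a e 3 \<ge> 0" "alpha_exp a e \<ge> 1" "beta_exp a e \<ge> 1"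
proof -
  have s: "s_exp a e j \<ge> 0" "shat_exp a e j \<ge> 0" if "j \<ge> 3" for j
  proof -
    have "\<forall>i\<in>{2..<e - 1}. a i \<ge> 2" "2 \<le> j - 1" "j - 1 + 1 = j" using assms that by auto
    then show "s_exp a e j \<ge> 0" "shat_exp a e j \<ge> 0"
      using s_exp_mono[of e a "j - 1"] s_exp_mono[of "e - 1" a "j - 1"] assms
      by (simp_all add: shat_exp_eq)
  qed
  then show "s_exp a e 3 \<ge> 0" "shat_exp a e 3 \<ge> 0" by auto
  show "alpha_exp a e \<ge> 1" "beta_exp a e \<ge> 1"
    unfolding alpha_exp_def beta_exp_def using s assms by (auto intro!: sum_nonneg)
qed

section \<open>The polynomial and the matrices\<close>

definition F_poly :: "(nat \<Rightarrow> int) \<Rightarrow> nat \<Rightarrow> cpoly3" where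
  "F_poly a e = (let \<alpha> = alpha_exp a e; \<beta> = beta_exp a e; s = s_exp a e 3; sh = shat_exp a e 3 in
     pY ^ nat (2 * \<alpha> + 2 * s) + pX ^ nat (a 2 - 1) * pY ^ nat (2 * \<alpha>) * pZ ^ nat (2 * sh)
       - pX * pZ ^ nat (2 * \<beta> + 2 * sh))"

definition A1 :: "(nat \<Rightarrow> int) \<Rightarrow> nat \<Rightarrow> int \<Rightarrow> int \<Rightarrow> cpoly3^2^2" where
  "A1 a e i j = (let \<alpha> = alpha_exp a e; \<beta> = beta_exp a e; s = s_exp a e 3; sh = shat_exp a e 3 in
     matrix2
       (pY ^ nat (2 * \<alpha> - i))        (pX * pZ ^ nat j)
       (pZ ^ nat (2 * \<beta> + 2 * sh - j)) (pY ^ nat i * (pY ^ nat (2 * s) + pX ^ nat (a 2 - 1) * pZ ^ nat (2 * sh))))"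

definition B1 :: "(nat \<Rightarrow> int) \<Rightarrow> nat \<Rightarrow> int \<Rightarrow> int \<Rightarrow> cpoly3^2^2" where
  "B1 a e i j = (let \<alpha> = alpha_exp a e; \<beta> = beta_exp a e; s = s_exp a e 3; sh = shat_exp a e 3 in
     matrix2
       (pY ^ nat i * (pY ^ nat (2 * s) + pX ^ nat (a 2 - 1) * pZ ^ nat (2 * sh))) (- (pX * pZ ^ nat j))
       (- (pZ ^ nat (2 * \<beta> + 2 * sh - j)))                                        (pY ^ nat (2 * \<alpha> - i)))"

definition A2 :: "(nat \<Rightarrow> int) \<Rightarrow> nat \<Rightarrow> int \<Rightarrow> cpoly3^2^2" where
  "A2 a e j = (let \<alpha> = alpha_exp a e; \<beta> = beta_exp a e; s = s_exp a e 3; sh = shat_exp a e 3 in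
     matrix2
       pX                              (pY ^ nat j)
       (- (pY ^ nat (2 * \<alpha> + 2 * s - j))) (pZ ^ nat (2 * sh) * (pX ^ nat (a 2 - 2) * pY ^ nat (2 * \<alpha>) - pZ ^ nat (2 * \<beta>))))"

definition B2 :: "(nat \<Rightarrow> int) \<Rightarrow> nat \<Rightarrow> int \<Rightarrow> cpoly3^2^2" where
  "B2 a e j = (let \<alpha> = alpha_exp a e; \<beta> = beta_exp a e; s = s_exp a e 3; sh = shat_exp a e 3 in
     matrix2
       (pZ ^ nat (2 * sh) * (pX ^ nat (a 2 - 2) * pY ^ nat (2 * \<alpha>) - pZ ^ nat (2 * \<beta>))) (- (pY ^ nat j))
       (pY ^ nat (2 * \<alpha> + 2 * s - j))                                                  pX)"

definition A3 :: "(nat \<Rightarrow> int) \<Rightarrow> nat \<Rightarrow> int \<Rightarrow> int \<Rightarrow> cpoly3^2^2" where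
  "A3 a e i j = (let \<alpha> = alpha_exp a e; \<beta> = beta_exp a e; s = s_exp a e 3; sh = shat_exp a e 3 in
     matrix2
       (pZ ^ nat (2 * sh - i))           (pY ^ nat j)
       (- (pY ^ nat (2 * \<alpha> + 2 * s - j))) (pX * pZ ^ nat i * (pX ^ nat (a 2 - 2) * pY ^ nat (2 * \<alpha>) - pZ ^ nat (2 * \<beta>))))"

definition B3 :: "(nat \<Rightarrow> int) \<Rightarrow> nat \<Rightarrow> int \<Rightarrow> int \<Rightarrow> cpoly3^2^2" where
  "B3 a e i j = (let \<alpha> = alpha_exp a e; \<beta> = beta_exp a e; s = s_exp a e 3; sh = shat_exp a e 3 in
     matrix2
       (pX * pZ ^ nat i * (pX ^ nat (a 2 - 2) * pY ^ nat (2 * \<alpha>) - pZ ^ nat (2 * \<beta>))) (- (pY ^ nat j))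
       (pY ^ nat (2 * \<alpha> + 2 * s - j))                                                  (pZ ^ nat (2 * sh - i)))"

end

theory Submission imports Defs begin

text \<open>In each family \<open>B\<close> is the adjugate of \<open>A\<close>, so both products are the scalar matrix \<open>det A\<close>,
  and \<open>det A = F\<close> by adding exponents.\<close>

text \<open>Off-diagonal entries of either product cancel because the ring is commutative; both
  diagonal entries are the determinant.\<close>

lemma matrix2_mult_adjugate:
  fixes p q r s :: "'a::comm_ring_1"
  shows "matrix2 p q r s ** matrix2 s (- q) (- r) p = mat (p * s - q * r)"
    and "matrix2 s (- q) (- r) p ** matrix2 p q r s = mat (p * s - q * r)"
  by (simp_all add: matrix2_def vec_eq_iff matrix_matrix_mult_def mat_def forall_2 sum_2 algebra_simps)

text \<open>Sign variant for families (ii) and (iii), where the minus sign sits in the lower left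
  corner of the first factor and the determinant becomes a sum.\<close>

lemma matrix2_mult_adjugate_neg:
  fixes p q r s :: "'a::comm_ring_1"
  shows "matrix2 p q (- r) s ** matrix2 s (- q) r p = mat (p * s + q * r)"
    and "matrix2 s (- q) r p ** matrix2 p q (- r) s = mat (p * s + q * r)"
  using matrix2_mult_adjugate[where p = p and q = q and r = "- r" and s = s] by simp_all

text \<open>\<open>nat\<close> sends negative integers to 0, so exponents add only under these sign
  conditions; the index ranges below supply them.\<close>

lemma power_nat_mult:
  fixes v :: "'a::monoid_mult"
  assumes "0 \<le> k" "0 \<le> l"
  shows "v ^ nat k * v ^ nat l = v ^ nat (k + l)"
  using assms by (simp add: nat_add_distrib power_add)

text \<open>The first two terms of F share the power \<open>pY ^ nat (2 * \<alpha>)\<close>. This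
  grouping matches the determinant of \<open>A1\<close>.\<close>

lemma F_poly_factor_y:
  assumes "\<forall>i\<in>{2..<e}. a i \<ge> 2"
  shows "F_poly a e =
    pY ^ nat (2 * alpha_exp a e)
        * (pY ^ nat (2 * s_exp a e 3) + pX ^ nat (a 2 - 1) * pZ ^ nat (2 * shat_exp a e 3))
      - pX * pZ ^ nat (2 * beta_exp a e + 2 * shat_exp a e 3)"
  using exponent_bounds[OF assms]
  by (simp add: F_poly_def Let_def nat_add_distrib power_add algebra_simps)

text \<open>Here the last two terms of F are grouped, which matches the determinants of
  \<open>A2\<close> and \<open>A3\<close>.\<close>

lemma F_poly_factor_xz:
  assumes "\<forall>i\<in>{2..<e}. a i \<ge> 2" and "4 \<le> e"
  shows "F_poly a e =
    pX * pZ ^ nat (2 * shat_exp a e 3)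
        * (pX ^ nat (a 2 - 2) * pY ^ nat (2 * alpha_exp a e) - pZ ^ nat (2 * beta_exp a e))
      + pY ^ nat (2 * alpha_exp a e + 2 * s_exp a e 3)"
proof -
  \<comment> \<open>As \<open>4 \<le> e\<close>, the index 2 is in range and
    \<open>a 2 \<ge> 2\<close>, so one factor \<open>pX\<close> splits off without
    truncation.\<close>
  have "nat (a 2 - 1) = Suc (nat (a 2 - 2))"
    using assms by force
  then show ?thesis
    using exponent_bounds[OF assms(1)]
    by (simp add: F_poly_def Let_def nat_add_distrib power_add algebra_simps)
qed

lemma A1_B1:
  assumes "\<forall>i\<in>{2..<e}. a i \<ge> 2"
    and "0 \<le> i" "i \<le> 2 * alpha_exp a e"
    and "0 \<le> j" "j \<le> 2 * beta_exp a e + 2 * shat_exp a e 3"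
  shows "A1 a e i j ** B1 a e i j = mat (F_poly a e)"
    and "B1 a e i j ** A1 a e i j = mat (F_poly a e)"
proof -
  \<comment> \<open>The trailing \<open>w\<close> lets this rewrite apply to the right-nested
    products produced by \<open>mult.assoc\<close>.\<close>
  have "pY ^ nat (2 * alpha_exp a e - i) * (pY ^ nat i * w) = pY ^ nat (2 * alpha_exp a e) * w" for w
    using assms by (simp add: power_nat_mult flip: mult.assoc)
  moreover have "pZ ^ nat j * pZ ^ nat (2 * beta_exp a e + 2 * shat_exp a e 3 - j)
      = pZ ^ nat (2 * beta_exp a e + 2 * shat_exp a e 3)"
    using assms by (simp add: power_nat_mult)
  ultimately show "A1 a e i j ** B1 a e i j = mat (F_poly a e)"
    and "B1 a e i j ** A1 a e i j = mat (F_poly a e)"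
    unfolding A1_def B1_def Let_def matrix2_mult_adjugate F_poly_factor_y[OF assms(1)]
    by (simp_all only: mult.assoc)
qed

lemma A2_B2:
  assumes "\<forall>i\<in>{2..<e}. a i \<ge> 2" and "4 \<le> e"
    and "0 \<le> j" "j \<le> 2 * alpha_exp a e + 2 * s_exp a e 3"
  shows "A2 a e j ** B2 a e j = mat (F_poly a e)"
    and "B2 a e j ** A2 a e j = mat (F_poly a e)"
proof -
  have "pY ^ nat j * pY ^ nat (2 * alpha_exp a e + 2 * s_exp a e 3 - j)
      = pY ^ nat (2 * alpha_exp a e + 2 * s_exp a e 3)"
    using assms by (simp add: power_nat_mult)
  then show "A2 a e j ** B2 a e j = mat (F_poly a e)"
    and "B2 a e j ** A2 a e j = mat (F_poly a e)"
    unfolding A2_def B2_def Let_def matrix2_mult_adjugate_neg F_poly_factor_xz[OF assms(1,2)]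
    by (simp_all only: mult.assoc)
qed

lemma A3_B3:
  assumes "\<forall>i\<in>{2..<e}. a i \<ge> 2" and "4 \<le> e"
    and "0 \<le> i" "i \<le> 2 * shat_exp a e 3"
    and "0 \<le> j" "j \<le> 2 * alpha_exp a e + 2 * s_exp a e 3"
  shows "A3 a e i j ** B3 a e i j = mat (F_poly a e)"
    and "B3 a e i j ** A3 a e i j = mat (F_poly a e)"
proof -
  have y: "pY ^ nat j * pY ^ nat (2 * alpha_exp a e + 2 * s_exp a e 3 - j)
      = pY ^ nat (2 * alpha_exp a e + 2 * s_exp a e 3)"
    using assms by (simp add: power_nat_mult)
  have "pZ ^ nat (2 * shat_exp a e 3 - i) * pZ ^ nat i = pZ ^ nat (2 * shat_exp a e 3)"
    using assms by (simp add: power_nat_mult)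
  \<comment> \<open>In the determinant of \<open>A3\<close> the factor \<open>pX\<close> separates
    the two powers of \<open>pZ\<close>, so it is moved to the front before they merge.\<close>
  then have "pZ ^ nat (2 * shat_exp a e 3 - i) * (pX * (pZ ^ nat i * w))
      = pX * (pZ ^ nat (2 * shat_exp a e 3) * w)" for w
    by (metis mult.assoc mult.left_commute)
  with y show "A3 a e i j ** B3 a e i j = mat (F_poly a e)"
    and "B3 a e i j ** A3 a e i j = mat (F_poly a e)"
    unfolding A3_def B3_def Let_def matrix2_mult_adjugate_neg F_poly_factor_xz[OF assms(1,2)]
    by (simp_all only: mult.assoc)
qed

theorem proposition5p1:
  fixes n q :: int and e :: nat and a :: "nat \<Rightarrow> int"
  assumes "coprime n q" and "1 < q" and "q < n"
    and "4 \<le> e"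
    and "is_hj_expansion (of_int n / of_int (n - q)) e a"
  shows "(\<forall>i j :: int. 0 \<le> i \<and> i \<le> 2 * alpha_exp a e - 1 \<and>
            0 \<le> j \<and> j \<le> 2 * beta_exp a e + 2 * shat_exp a e 3 - 1 \<longrightarrow>
            A1 a e i j ** B1 a e i j = mat (F_poly a e) \<and>
            B1 a e i j ** A1 a e i j = mat (F_poly a e) \<and>
            is_matrix_factorization (F_poly a e) (A1 a e i j, B1 a e i j))
       \<and> (\<forall>j :: int. 1 \<le> j \<and> j \<le> 2 * alpha_exp a e + 2 * s_exp a e 3 - 1 \<longrightarrow>
            A2 a e j ** B2 a e j = mat (F_poly a e) \<and>
            B2 a e j ** A2 a e j = mat (F_poly a e) \<and>
            is_matrix_factorization (F_poly a e) (A2 a e j, B2 a e j))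
       \<and> (\<forall>i j :: int. 0 \<le> i \<and> i \<le> 2 * shat_exp a e 3 - 1 \<and>
            1 \<le> j \<and> j \<le> 2 * alpha_exp a e + 2 * s_exp a e 3 - 1 \<longrightarrow>
            A3 a e i j ** B3 a e i j = mat (F_poly a e) \<and>
            B3 a e i j ** A3 a e i j = mat (F_poly a e) \<and>
            is_matrix_factorization (F_poly a e) (A3 a e i j, B3 a e i j))"
proof -
  have a: "\<forall>i\<in>{2..<e}. a i \<ge> 2"
    using assms(5) by (simp add: is_hj_expansion_def)
  show ?thesis
    \<comment> \<open>Being a matrix factorization unfolds to the same two product equations, and
      the index ranges lie within those of the three lemmas.\<close>
    unfolding is_matrix_factorization_def fst_conv snd_conv
    using A1_B1[OF a] A2_B2[OF a assms(4)] A3_B3[OF a assms(4)] by simp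
qed

end
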